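(* Let $X$ be a proper metric space with a consistent bicombing $\sigma$. Let $\Gamma$ be a group acting properly and cocompactly by isometries on $X$, and suppose that $\sigma$ is $\Gamma$-equivariant. If $\Gamma$ has a free abelian subgroup $A$ of rank $n\ge 1$, then $X$ contains an isometrically embedded $n$-dimensional normed space on which $A$ acts by translations.
   Context: Metric spaces are understood to be non-empty. Bicombing: for a metric space $(X,d)$, a bicombing is a map $\sigma\colon X\times X\times[0,1]\to X$ such that the maps $\sigma_{xy}:=\sigma(x,y,\cdot)\colon[0,1]\to X$ satisfy, for all $x,y,x',y'\in X$: (i) $\sigma_{xy}(0)=x$, $\sigma_{xy}(1)=y$, and $d(\sigma_{xy}(t),\sigma_{xy}(t'))=|t-t'|\,d(x,y)$ for $t,t'\in[0,1]$; (ii) $\sigma_{yx}(t)=\sigma_{xy}(1-t)$ for $t\in[0,1]$; (iii) $d(\sigma_{xy}(t),\sigma_{x'y'}(t))\le(1-t)\,d(x,x')+t\,d(y,y')$ for $t\in[0,1]$. The bicombing is consistent if in addition (iv) $\operatorname{im}(\sigma_{pq})\subset\operatorname{im}(\sigma_{xy})$ whenever $p=\sigma_{xy}(r)$ and $q=\sigma_{xy}(s)$ with $r\le s$. It is $\Gamma$-equivariant if $\gamma\circ\sigma_{xy}=\sigma_{\gamma(x)\gamma(y)}$ for all $\gamma\in\Gamma$ and $(x,y)\in X\times X$. A metric space is proper if its closed balls are compact. The action is proper if every $x\in X$ has a ball $B(x,r)$, $r>0$, such that $\{\gamma\in\Gamma:\gamma B(x,r)\cap B(x,r)\ne\emptyset\}$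 is finite; it is cocompact if there is a compact set $K\subset X$ with $\bigcup_{\gamma\in\Gamma}\gamma K=X$. The conclusion means precisely: fixing an isomorphism $\iota\colon(\mathbb{Z}^n,+)\to A$, there exist a norm $\|\cdot\|$ on $\mathbb{R}^n$ and an isometric (distance-preserving) embedding $f\colon(\mathbb{R}^n,\|\cdot\|)\to X$ such that $\iota(a)f(p)=f(p+a)$ for all $p\in\mathbb{R}^n$ and $a\in\mathbb{Z}^n$. *)

theory Defs
  imports "HOL-Analysis.Analysis" "HOL-Algebra.Group_Action"
begin

text \<open>A metric space is a type of class \<^class>\<open>metric_space\<close> (hence non-empty).\<close>

definition proper_space :: "'x::metric_space itself \<Rightarrow> bool" where
  "proper_space _ \<longleftrightarrow> (\<forall>(x::'x) r. compact (cball x r))"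

text \<open>Bicombings are maps on \<open>X \<times> X \<times> [0,1]\<close>; the values of \<open>\<sigma> x y\<close> outside
  \<open>[0,1]\<close> are irrelevant and never constrained.\<close>

definition bicombing :: "('x::metric_space \<Rightarrow> 'x \<Rightarrow> real \<Rightarrow> 'x) \<Rightarrow> bool" where
  "bicombing \<sigma> \<longleftrightarrow>
     (\<forall>x y. \<sigma> x y 0 = x \<and> \<sigma> x y 1 = y \<and>
        (\<forall>t\<in>{0..1}. \<forall>t'\<in>{0..1}. dist (\<sigma> x y t) (\<sigma> x y t') = \<bar>t - t'\<bar> * dist x y)) \<and>
     (\<forall>x y. \<forall>t\<in>{0..1}. \<sigma> y x t = \<sigma> x y (1 - t)) \<and>
     (\<forall>x y x' y'. \<forall>t\<in>{0..1}.
        dist (\<sigma> x y t) (\<sigma> x' y' t) \<le> (1 - t) * dist x x' + t * dist y y')"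

definition consistent_bicombing :: "('x::metric_space \<Rightarrow> 'x \<Rightarrow> real \<Rightarrow> 'x) \<Rightarrow> bool" where
  "consistent_bicombing \<sigma> \<longleftrightarrow> bicombing \<sigma> \<and>
     (\<forall>x y p q. \<forall>r\<in>{0..1}. \<forall>s\<in>{0..1}. r \<le> s \<and> p = \<sigma> x y r \<and> q = \<sigma> x y s \<longrightarrow>
        \<sigma> p q ` {0..1} \<subseteq> \<sigma> x y ` {0..1})"

definition isometric_action ::
    "('g, 'm) monoid_scheme \<Rightarrow> ('g \<Rightarrow> 'x::metric_space \<Rightarrow> 'x) \<Rightarrow> bool" where
  "isometric_action G \<phi> \<longleftrightarrow> group_action G UNIV \<phi> \<and>
     (\<forall>g\<in>carrier G. \<forall>x y. dist (\<phi> g x) (\<phi> g y) = dist x y)"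

definition proper_action ::
    "('g, 'm) monoid_scheme \<Rightarrow> ('g \<Rightarrow> 'x::metric_space \<Rightarrow> 'x) \<Rightarrow> bool" where
  "proper_action G \<phi> \<longleftrightarrow>
     (\<forall>x. \<exists>r>0. finite {g \<in> carrier G. \<phi> g ` ball x r \<inter> ball x r \<noteq> {}})"

definition cocompact_action ::
    "('g, 'm) monoid_scheme \<Rightarrow> ('g \<Rightarrow> 'x::metric_space \<Rightarrow> 'x) \<Rightarrow> bool" where
  "cocompact_action G \<phi> \<longleftrightarrow> (\<exists>K. compact K \<and> (\<Union>g\<in>carrier G. \<phi> g ` K) = UNIV)"

definition equivariant_bicombing ::
    "('g, 'm) monoid_scheme \<Rightarrow> ('g \<Rightarrow> 'x::metric_space \<Rightarrow> 'x) \<Rightarrow>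
     ('x \<Rightarrow> 'x \<Rightarrow> real \<Rightarrow> 'x) \<Rightarrow> bool" where
  "equivariant_bicombing G \<phi> \<sigma> \<longleftrightarrow>
     (\<forall>g\<in>carrier G. \<forall>x y. \<forall>t\<in>{0..1}. \<phi> g (\<sigma> x y t) = \<sigma> (\<phi> g x) (\<phi> g y) t)"

definition int_vec_group :: "(int ^ 'n) monoid" where
  "int_vec_group = \<lparr>carrier = UNIV, monoid.mult = (+), one = 0\<rparr>"

definition real_vec :: "int ^ 'n \<Rightarrow> real ^ 'n" where
  "real_vec a = (\<chi> i. real_of_int (a $ i))"

text \<open>An arbitrary norm on a real vector space, in general different from the norm
  \<^const>\<open>norm\<close> that the type may carry.\<close>

definition is_norm :: "('v::real_vector \<Rightarrow> real) \<Rightarrow> bool" where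
  "is_norm N \<longleftrightarrow>
     (\<forall>v. 0 \<le> N v) \<and> (\<forall>v. N v = 0 \<longleftrightarrow> v = 0) \<and>
     (\<forall>c v. N (c *\<^sub>R v) = \<bar>c\<bar> * N v) \<and> (\<forall>v w. N (v + w) \<le> N v + N w)"

end

theory Submission
  imports Defs
begin

text \<open>Only the midpoint map of the bicombing is used. For an \<open>A\<close>-equivariant map \<open>f\<close> from
  \<open>\<real>\<^sup>n\<close> to \<open>X\<close> let \<open>|f|\<^sub>w\<close> be the supremum of \<open>d(f(p), f(p + w))\<close> over \<open>p\<close>, and let \<open>T\<^sub>v f(p)\<close> be the
  midpoint of \<open>f(p)\<close> and \<open>f(p + v)\<close>. Then \<open>T\<^sub>v f\<close> is equivariant, \<open>|T\<^sub>v f|\<^sub>w \<le> |f|\<^sub>w\<close> for all \<open>w\<close>, and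
  \<open>|T\<^sub>v f|\<^sub>v \<le> |f|\<^sub>2\<^sub>v / 2\<close>. Starting from the step map \<open>p \<mapsto> \<lfloor>p\<rfloor> x\<^sub>0\<close> and iterating over \<open>v, 2v, 4v, \<dots>\<close>,
  one brings \<open>|f|\<^sub>v\<close>, for finitely many \<open>v\<close> at once, arbitrarily close to the stable length \<open>N(v)\<close>,
  the limit of \<open>|f|\<^sub>t\<^sub>v / t\<close> for \<open>t \<rightarrow> \<infinity>\<close>. Translating \<open>f(0)\<close> into a compact set by some \<open>\<gamma>\<close> leaves,
  by properness, only finitely many conjugates of the action of \<open>A\<close>, so Tychonoff's theorem yields
  an equivariant \<open>f\<close> with \<open>|f|\<^sub>v \<le> N(v)\<close> for all \<open>v\<close>. Conversely \<open>d(x, ax) \<ge> N(a)\<close> for \<open>a \<in> A\<close>, and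
  approximating multiples of \<open>v\<close> by lattice points turns this into \<open>d(f(p), f(p + v)) \<ge> N(v)\<close>.\<close>

section \<open>Homogenisation of a symmetric subadditive function\<close>

locale symmetric_subadditive =
  fixes D :: "'v::real_normed_vector \<Rightarrow> real"
  assumes subadd: "D (v + w) \<le> D v + D w"
    and nonneg: "0 \<le> D v"
    and minus: "D (- v) = D v"
    and bounded: "\<exists>B. \<forall>v. norm v \<le> M \<longrightarrow> D v \<le> B"
begin

text \<open>The limit of \<open>D (t *\<^sub>R v) / t\<close> for large \<open>t\<close>, encoded as
  an infimum so that every single \<open>t\<close> gives an upper bound;
  \<open>stable_approx\<close> recovers the limit.\<close>

definition stable :: "'v \<Rightarrow> real" where
  "stable v = (INF t\<in>{0<..}. D (t *\<^sub>R v) / t)"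

lemma stable_le: "t > 0 \<Longrightarrow> stable v \<le> D (t *\<^sub>R v) / t"
  unfolding stable_def
  by (rule cINF_lower) (auto intro!: bdd_belowI[of _ 0] divide_nonneg_pos nonneg)

lemma stable_le_self: "stable v \<le> D v"
  using stable_le[of 1 v] by simp

lemma stable_greatest: "(\<And>t. t > 0 \<Longrightarrow> c \<le> D (t *\<^sub>R v) / t) \<Longrightarrow> c \<le> stable v"
  unfolding stable_def by (rule cINF_greatest) (auto intro: exI[of _ 1])

lemma stable_nonneg: "0 \<le> stable v"
  by (rule stable_greatest) (simp add: nonneg)

text \<open>The summand \<open>D 0\<close> covers \<open>n = 0\<close>; the locale does not force
  \<open>D 0 = 0\<close>.\<close>

lemma subadd_of_nat: "D (real n *\<^sub>R v) \<le> real n * D v + D 0"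
proof (induction n)
  case (Suc n)
  have "D (real (Suc n) *\<^sub>R v) = D (v + real n *\<^sub>R v)" by (simp add: algebra_simps)
  also have "\<dots> \<le> D v + D (real n *\<^sub>R v)" by (rule subadd)
  finally show ?case using Suc by (simp add: algebra_simps)
qed simp

text \<open>Fekete's argument: the infimum is a limit.\<close>

lemma stable_approx:
  assumes "\<epsilon> > 0"
  obtains T where "T > 0" "\<And>t. t \<ge> T \<Longrightarrow> D (t *\<^sub>R v) \<le> t * (stable v + \<epsilon>)"
proof -
  obtain s where s: "s > 0" "D (s *\<^sub>R v) / s < stable v + \<epsilon> / 2"
  proof (rule ccontr)
    assume "\<not> thesis"
    then have "stable v + \<epsilon> / 2 \<le> stable v"
      by (intro stable_greatest) (metis that linorder_not_less)
    then show False using assms by simp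
  qed
  \<comment> \<open>Below, \<open>t\<close> is divided by \<open>s\<close> with remainder
    \<open>r\<close>, so \<open>r *\<^sub>R v\<close> stays in a fixed ball; boundedness on it
    stands in for continuity of \<open>D\<close>.\<close>
  obtain B where B: "\<And>w. norm w \<le> s * norm v \<Longrightarrow> D w \<le> B"
    using bounded[of "s * norm v"] by blast
  have B0: "B \<ge> D 0" using B[of 0] s by simp
  then have Bpos: "B \<ge> 0" using nonneg[of 0] by linarith
  \<comment> \<open>The total error is at most \<open>2 * B\<close>, one \<open>B\<close> for
    \<open>r *\<^sub>R v\<close> and one for \<open>D 0\<close>. The threshold pushes it below
    \<open>t * (\<epsilon> / 2)\<close>, and the \<open>+ 1\<close> keeps \<open>t\<close> positive
    when \<open>B = 0\<close>.\<close>
  have main: "D (t *\<^sub>R v) \<le> t * (stable v + \<epsilon>)" if t: "t \<ge> 4 * B / \<epsilon> + 1" for t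
  proof -
    have "0 \<le> 4 * B / \<epsilon>" using Bpos assms by simp
    then have t0: "t > 0" using t by linarith
    have "4 * B / \<epsilon> \<le> t" using t by linarith
    then have tB: "2 * B \<le> t * (\<epsilon> / 2)" using assms by (simp add: field_simps)
    define m where "m = nat \<lfloor>t / s\<rfloor>"
    have m: "real m = of_int \<lfloor>t / s\<rfloor>" using t0 s by (simp add: m_def)
    have m1: "real m \<le> t / s" and m2: "t / s < real m + 1" unfolding m by linarith+
    define r where "r = t - real m * s"
    have r: "0 \<le> r" "r \<le> s" using m1 m2 s by (auto simp: r_def field_simps)
    have "t *\<^sub>R v = real m *\<^sub>R (s *\<^sub>R v) + r *\<^sub>R v" by (simp add: r_def algebra_simps)
    then have "D (t *\<^sub>R v) \<le> D (real m *\<^sub>R (s *\<^sub>R v)) + D (r *\<^sub>R v)" by (metis subadd)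
    also have "D (real m *\<^sub>R (s *\<^sub>R v)) \<le> real m * D (s *\<^sub>R v) + D 0" by (rule subadd_of_nat)
    also have "D (r *\<^sub>R v) \<le> B" using r by (intro B) (simp add: mult_right_mono)
    also have "real m * D (s *\<^sub>R v) \<le> real m * (s * (stable v + \<epsilon> / 2))"
      using s by (intro mult_left_mono) (auto simp: field_simps)
    also have "real m * (s * (stable v + \<epsilon> / 2)) \<le> t * (stable v + \<epsilon> / 2)"
      using r(1) stable_nonneg[of v] assms
      unfolding r_def mult.assoc[symmetric] by (intro mult_right_mono) auto
    finally have "D (t *\<^sub>R v) \<le> t * (stable v + \<epsilon> / 2) + 2 * B" using B0 by linarith
    also have "\<dots> \<le> t * (stable v + \<epsilon>)" using tB by (simp add: algebra_simps)
    finally show ?thesis .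
  qed
  show ?thesis
    by (rule that[of "4 * B / \<epsilon> + 1"]) (use Bpos assms main in \<open>auto intro: add_nonneg_pos\<close>)
qed

text \<open>Near-optimal scales for \<open>v\<close> and \<open>w\<close> may differ, so the infimum
  alone is not enough; past both thresholds of \<open>stable_approx\<close> one scale serves
  both.\<close>

lemma stable_triangle: "stable (v + w) \<le> stable v + stable w"
proof (rule field_le_epsilon)
  fix e :: real assume "e > 0"
  then have e: "e / 2 > 0" by simp
  obtain S where S: "S > 0" "\<And>t. t \<ge> S \<Longrightarrow> D (t *\<^sub>R v) \<le> t * (stable v + e / 2)"
    using stable_approx[OF e] by metis
  obtain T where T: "T > 0" "\<And>t. t \<ge> T \<Longrightarrow> D (t *\<^sub>R w) \<le> t * (stable w + e / 2)"
    using stable_approx[OF e] by metis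
  define t where "t = max S T"
  have t: "t > 0" using S by (simp add: t_def)
  have "stable (v + w) \<le> D (t *\<^sub>R v + t *\<^sub>R w) / t"
    using stable_le[OF t, of "v + w"] by (simp add: algebra_simps)
  also have "\<dots> \<le> (D (t *\<^sub>R v) + D (t *\<^sub>R w)) / t"
    using t by (intro divide_right_mono subadd) simp
  also have "\<dots> \<le> (t * (stable v + e / 2) + t * (stable w + e / 2)) / t"
    using t S(2)[of t] T(2)[of t] by (intro divide_right_mono) (auto simp: t_def)
  also have "\<dots> = stable v + stable w + e" using t by (simp add: field_simps)
  finally show "stable (v + w) \<le> stable v + stable w + e" .
qed

lemma stable_minus: "stable (- v) = stable v"
  unfolding stable_def by (simp add: minus)

lemma stable_zero: "stable 0 = 0"
proof -
  have "stable 0 \<le> 0 + e" if "e > 0" for e :: real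
  proof -
    have pos: "(D 0 + 1) / e > 0" using that nonneg[of 0] by (intro divide_pos_pos) auto
    have "stable 0 \<le> D 0 / ((D 0 + 1) / e)" using stable_le[OF pos, of 0] by simp
    also have "\<dots> = D 0 / (D 0 + 1) * e" by simp
    also have "\<dots> \<le> 1 * e" using that nonneg[of 0] by (intro mult_right_mono) auto
    finally show ?thesis by simp
  qed
  then have "stable 0 \<le> 0" by (metis field_le_epsilon)
  then show ?thesis using stable_nonneg[of 0] by linarith
qed

lemma stable_scaleR_le: "c > 0 \<Longrightarrow> c * stable v \<le> stable (c *\<^sub>R v)"
proof (rule stable_greatest)
  fix t :: real assume "c > 0" "t > 0"
  then show "c * stable v \<le> D (t *\<^sub>R c *\<^sub>R v) / t"
    using stable_le[of "t * c" v] by (simp add: field_simps)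
qed

lemma stable_scaleR: "stable (c *\<^sub>R v) = \<bar>c\<bar> * stable v"
proof -
  have pos: "stable (c *\<^sub>R v) = c * stable v" if "c > 0" for c v
  proof (rule antisym)
    have "1 / c * stable (c *\<^sub>R v) \<le> stable v"
      using stable_scaleR_le[of "1 / c" "c *\<^sub>R v"] that by simp
    then show "stable (c *\<^sub>R v) \<le> c * stable v" using that by (simp add: field_simps)
  qed (rule stable_scaleR_le[OF that])
  consider "c > 0" | "c = 0" | "c < 0" by linarith
  then show ?thesis
  proof cases
    case 3
    then have "stable (- ((- c) *\<^sub>R v)) = - c * stable v"
      unfolding stable_minus using pos[of "- c" v] by simp
    then show ?thesis using 3 by simp
  qed (simp_all add: pos stable_zero)
qed

text \<open>Homogeneity spreads the bound of \<open>D\<close> on the unit ball. The purpose is to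
  make \<open>stable\<close> small on short error vectors.\<close>

lemma stable_bounded_by_norm:
  obtains B where "B > 0" "\<And>v. stable v \<le> B * norm v"
proof -
  obtain B where B: "\<And>v. norm v \<le> 1 \<Longrightarrow> D v \<le> B" using bounded[of 1] by blast
  have "stable v \<le> (\<bar>B\<bar> + 1) * norm v" for v
  proof (cases "v = 0")
    case False
    then have "stable (inverse (norm v) *\<^sub>R v) \<le> B"
      by (intro order.trans[OF stable_le_self] B) simp
    then have "inverse (norm v) * stable v \<le> B" by (simp add: stable_scaleR)
    then have "stable v \<le> B * norm v" using False by (simp add: field_simps)
    also have "\<dots> \<le> (\<bar>B\<bar> + 1) * norm v" by (intro mult_right_mono) auto
    finally show ?thesis .
  qed (simp add: stable_zero)
  then show ?thesis using that[of "\<bar>B\<bar> + 1"] by simp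
qed

end

section \<open>The integer lattice in real space\<close>

definition floor_vec :: "real ^ 'n \<Rightarrow> int ^ 'n" where
  "floor_vec p = (\<chi> i. \<lfloor>p $ i\<rfloor>)"

lemma floor_vec_add_real_vec: "floor_vec (p + real_vec a) = a + floor_vec p"
  by (simp add: floor_vec_def real_vec_def vec_eq_iff)

lemma real_vec_zero [simp]: "real_vec 0 = 0"
  by (simp add: real_vec_def vec_eq_iff)

lemma real_vec_add: "real_vec (a + b) = real_vec a + real_vec b"
  by (simp add: real_vec_def vec_eq_iff)

lemma real_vec_diff: "real_vec (a - b) = real_vec a - real_vec b"
  by (simp add: real_vec_def vec_eq_iff)

lemma norm_minus_floor_vec_le:
  "norm (p - real_vec (floor_vec p) :: real ^ 'n) \<le> CARD('n)"
proof -
  have "norm (p - real_vec (floor_vec p)) \<le> (\<Sum>i\<in>UNIV. \<bar>(p - real_vec (floor_vec p)) $ i\<bar>)"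
    by (rule norm_le_l1_cart)
  also have "\<dots> \<le> (\<Sum>i\<in>(UNIV::'n set). 1)"
    by (intro sum_mono) (auto simp: floor_vec_def real_vec_def abs_le_iff; linarith)
  finally show ?thesis by simp
qed

lemma finite_int_vec_box: "finite {a :: int ^ 'n. \<forall>i. \<bar>a $ i\<bar> \<le> M}"
proof (rule finite_subset)
  show "{a :: int ^ 'n. \<forall>i. \<bar>a $ i\<bar> \<le> M} \<subseteq> vec_lambda ` Pi\<^sub>E UNIV (\<lambda>_. {-M..M})"
    by (auto intro!: image_eqI[where x = "vec_nth _"] simp: PiE_def abs_le_iff)
       (metis minus_le_iff)
  show "finite (vec_lambda ` Pi\<^sub>E (UNIV :: 'n set) (\<lambda>_. {-M..M}))"
    by (intro finite_imageI finite_PiE) auto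
qed

text \<open>Dirichlet approximation by compactness: the fractional parts of the multiples of
  \<open>w\<close> are bounded, so two late terms of a convergent subsequence are close, and their
  difference provides \<open>m\<close> and \<open>a\<close>.\<close>

lemma simultaneous_approximation:
  fixes w :: "real ^ 'n"
  assumes "\<epsilon> > 0"
  obtains m a where "m > 0" "norm (real m *\<^sub>R w - real_vec a) < \<epsilon>"
proof -
  define x where "x k = real k *\<^sub>R w - real_vec (floor_vec (real k *\<^sub>R w))" for k
  have "bounded (range x)"
    unfolding bounded_iff x_def using norm_minus_floor_vec_le by blast
  then obtain l r where r: "strict_mono r" "(x \<circ> r) \<longlonglongrightarrow> l"
    using bounded_imp_convergent_subsequence by metis
  then have "Cauchy (x \<circ> r)" using LIMSEQ_imp_Cauchy by blast
  then obtain M where M: "\<And>i j. i \<ge> M \<Longrightarrow> j \<ge> M \<Longrightarrow> norm ((x \<circ> r) i - (x \<circ> r) j) < \<epsilon>"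
    using assms unfolding Cauchy_iff by metis
  have lt: "r M < r (Suc M)" using r by (simp add: strict_mono_Suc_iff)
  show ?thesis
  proof (rule that)
    show "r (Suc M) - r M > 0" using lt by simp
    have "real (r (Suc M) - r M) *\<^sub>R w -
        real_vec (floor_vec (real (r (Suc M)) *\<^sub>R w) - floor_vec (real (r M) *\<^sub>R w))
        = (x \<circ> r) (Suc M) - (x \<circ> r) M"
      using lt by (simp add: x_def real_vec_diff of_nat_diff algebra_simps)
    then show "norm (real (r (Suc M) - r M) *\<^sub>R w -
        real_vec (floor_vec (real (r (Suc M)) *\<^sub>R w) - floor_vec (real (r M) *\<^sub>R w))) < \<epsilon>"
      using M[of "Suc M" M] by simp
  qed
qed

text \<open>The set where \<open>P\<close> holds is a subgroup containing the basis. Closure is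
  asked for differences because agreement of two homomorphisms passes to them by
  cancellation.\<close>

lemma additive_induct_int_vec:
  fixes P :: "int ^ 'n \<Rightarrow> bool"
  assumes axis: "\<And>i. P (axis i 1)"
    and diff: "\<And>a b. P a \<Longrightarrow> P b \<Longrightarrow> P (a - b)"
  shows "P a"
proof -
  \<comment> \<open>One arbitrary axis vector minus itself; the index type is nonempty.\<close>
  have zero: "P 0" using diff[OF axis axis, of undefined undefined] by simp
  have neg: "P (- b)" if "P b" for b using diff[OF zero that] by simp
  have add: "P (b + c)" if "P b" "P c" for b c using diff[OF that(1) neg[OF that(2)]] by simp
  have nat: "P (axis i (int k))" for i k
  proof (induction k)
    case 0
    have "axis i 0 = (0 :: int ^ 'n)" by (simp add: axis_def vec_eq_iff)
    then show ?case using zero by (metis of_nat_0)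
  next
    case (Suc k)
    have "axis i (int (Suc k)) = axis i 1 + (axis i (int k) :: int ^ 'n)"
      by (simp add: axis_def vec_eq_iff)
    then show ?case using add axis Suc by simp
  qed
  have int: "P (axis i k)" for i k
  proof (cases "k \<ge> 0")
    case True
    then show ?thesis using nat[of i "nat k"] by simp
  next
    case False
    have "axis i k = - (axis i (int (nat (- k))) :: int ^ 'n)"
      using False by (simp add: axis_def vec_eq_iff)
    then show ?thesis using neg[OF nat] by metis
  qed
  have "P (\<Sum>i\<in>S. axis i (a $ i))" for S
    by (induction S rule: infinite_finite_induct) (use zero add int in auto)
  moreover have "(\<Sum>i\<in>UNIV. axis i (a $ i)) = a"
    by (simp add: vec_eq_iff axis_def if_distrib cong: if_cong)
  ultimately show ?thesis by metis
qed

section \<open>Averaging of maps equivariant under a lattice action\<close>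

lemma dist_triangle_path: "dist x w \<le> dist x y + dist y z + dist z w"
  by (rule order.trans[OF dist_triangle[of x w z] add_right_mono[OF dist_triangle]])

locale lattice_action =
  fixes m :: "'x::metric_space \<Rightarrow> 'x \<Rightarrow> 'x"
    and \<psi> :: "int ^ 'n \<Rightarrow> 'x \<Rightarrow> 'x"
    and x\<^sub>0 :: 'x
  assumes mid_commute: "m x y = m y x"
    and mid_conical: "dist (m x y) (m x' y') \<le> (dist x x' + dist y y') / 2"
    and act_zero: "\<psi> 0 x = x"
    and act_add: "\<psi> (a + b) x = \<psi> a (\<psi> b x)"
    and act_isometry: "dist (\<psi> a x) (\<psi> a y) = dist x y"
    and act_mid: "\<psi> a (m x y) = m (\<psi> a x) (\<psi> a y)"
begin

definition equivariant :: "(real ^ 'n \<Rightarrow> 'x) \<Rightarrow> bool" where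
  "equivariant f \<longleftrightarrow> (\<forall>p a. \<psi> a (f p) = f (p + real_vec a))"

text \<open>Equivariant maps may be discontinuous here, so a map constant on half-open unit cubes
  can start the iteration.\<close>

definition step :: "real ^ 'n \<Rightarrow> 'x" where
  "step p = \<psi> (floor_vec p) x\<^sub>0"

definition displ :: "real ^ 'n \<Rightarrow> real" where
  "displ w = (SUP p. dist (step p) (step (p + w)))"

lemma equivariant_step: "equivariant step"
  by (simp add: equivariant_def step_def floor_vec_add_real_vec act_add)

lemma dist_act: "dist (\<psi> a x) (\<psi> b x) = dist x (\<psi> (b - a) x)"
  using act_isometry[of a x "\<psi> (b - a) x"] by (simp add: act_add[symmetric])

text \<open>By \<open>dist_act\<close> the distance depends only on the difference of the two floor
  vectors, and a bounded \<open>w\<close> leaves finitely many such differences.\<close>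

lemma step_bounded:
  obtains B where "\<And>w p. norm w \<le> M \<Longrightarrow> dist (step p) (step (p + w)) \<le> B"
proof -
  \<comment> \<open>Rounding changes a difference of coordinates by less than 1, hence the
    \<open>+ 1\<close>.\<close>
  define F where "F = {a :: int ^ 'n. \<forall>i. \<bar>a $ i\<bar> \<le> \<lceil>M\<rceil> + 1}"
  define B where "B = Max ((\<lambda>a. dist x\<^sub>0 (\<psi> a x\<^sub>0)) ` F)"
  have fin: "finite F" unfolding F_def by (rule finite_int_vec_box)
  have "dist (step p) (step (p + w)) \<le> B" if w: "norm w \<le> M" for w p
  proof -
    have "\<bar>(floor_vec (p + w) - floor_vec p) $ i\<bar> \<le> \<lceil>M\<rceil> + 1" for i
    proof -
      have "\<bar>w $ i\<bar> \<le> M" using component_le_norm_cart[of w i] w by linarith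
      then show ?thesis by (simp add: floor_vec_def) linarith
    qed
    then have "floor_vec (p + w) - floor_vec p \<in> F" by (simp add: F_def)
    then show ?thesis unfolding step_def dist_act B_def using fin by (intro Max_ge) auto
  qed
  then show ?thesis using that by blast
qed

lemma dist_step_le_displ: "dist (step p) (step (p + w)) \<le> displ w"
proof -
  obtain B where "\<And>p. dist (step p) (step (p + w)) \<le> B"
    using step_bounded[of "norm w"] by (metis order_refl)
  then have "bdd_above (range (\<lambda>p. dist (step p) (step (p + w))))"
    by (intro bdd_aboveI[of _ B]) auto
  then show ?thesis unfolding displ_def by (rule cSUP_upper[OF UNIV_I])
qed

lemma displ_least: "(\<And>p. dist (step p) (step (p + w)) \<le> c) \<Longrightarrow> displ w \<le> c"
  unfolding displ_def by (rule cSUP_least) auto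

sublocale symmetric_subadditive displ
proof
  fix v w :: "real ^ 'n" and M :: real
  show "displ (v + w) \<le> displ v + displ w"
  proof (rule displ_least)
    fix p
    show "dist (step p) (step (p + (v + w))) \<le> displ v + displ w"
      using dist_triangle[of "step p" "step (p + (v + w))" "step (p + v)"]
        dist_step_le_displ[of p v] dist_step_le_displ[of "p + v" w]
      by (simp add: add.assoc)
  qed
  show "0 \<le> displ v"
    using dist_step_le_displ[of 0 v] zero_le_dist order.trans by blast
  have le: "displ (- v) \<le> displ v" for v
  proof (rule displ_least)
    fix p show "dist (step p) (step (p + - v)) \<le> displ v"
      using dist_step_le_displ[of "p - v" v] by (simp add: dist_commute)
  qed
  show "displ (- v) = displ v" using le[of v] le[of "- v"] by simp
  obtain B where "\<And>w p. norm w \<le> M \<Longrightarrow> dist (step p) (step (p + w)) \<le> B"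
    using step_bounded by metis
  then show "\<exists>B. \<forall>v. norm v \<le> M \<longrightarrow> displ v \<le> B" by (metis displ_least)
qed

lemma displ_real_vec: "displ (real_vec a) = dist x\<^sub>0 (\<psi> a x\<^sub>0)"
proof -
  have "dist (step p) (step (p + real_vec a)) = dist x\<^sub>0 (\<psi> a x\<^sub>0)" for p
    unfolding step_def floor_vec_add_real_vec dist_act by simp
  then show ?thesis unfolding displ_def by simp
qed

definition average :: "real ^ 'n \<Rightarrow> (real ^ 'n \<Rightarrow> 'x) \<Rightarrow> real ^ 'n \<Rightarrow> 'x" where
  "average v f p = m (f p) (f (p + v))"

lemma equivariant_average: "equivariant f \<Longrightarrow> equivariant (average v f)"
  by (simp add: equivariant_def average_def act_mid algebra_simps)

text \<open>The two segments have both pairs of endpoints displaced by the same \<open>w\<close>, so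
  the conical inequality averages two numbers that are at most \<open>c\<close>. Hence averaging
  spoils no bound reached earlier.\<close>

lemma average_displ_le:
  assumes "\<And>p. dist (f p) (f (p + w)) \<le> c"
  shows "dist (average v f p) (average v f (p + w)) \<le> c"
proof -
  have "dist (average v f p) (average v f (p + w))
      \<le> (dist (f p) (f (p + w)) + dist (f (p + v)) (f (p + w + v))) / 2"
    unfolding average_def by (rule mid_conical)
  also have "p + w + v = p + v + w" by (simp add: algebra_simps)
  finally show ?thesis using assms[of p] assms[of "p + v"] by simp
qed

text \<open>Reversing one of the two segments makes them share the endpoint \<open>f (p + v)\<close>.\<close>

lemma average_displ_halved:
  assumes "\<And>p. dist (f p) (f (p + 2 *\<^sub>R v)) \<le> c"
  shows "dist (average v f p) (average v f (p + v)) \<le> c / 2"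
proof -
  have "average v f (p + v) = m (f (p + 2 *\<^sub>R v)) (f (p + v))"
    unfolding average_def by (subst mid_commute) (simp add: algebra_simps scaleR_2)
  then have "dist (average v f p) (average v f (p + v))
      \<le> (dist (f p) (f (p + 2 *\<^sub>R v)) + dist (f (p + v)) (f (p + v))) / 2"
    by (simp only:) (simp only: average_def mid_conical)
  then show ?thesis using assms[of p] by simp
qed

text \<open>The averages run along \<open>2 ^ (k - 1) *\<^sub>R v\<close> first and \<open>v\<close>
  last, each halving the bound from which the next one starts. The induction therefore applies its
  hypothesis to \<open>2 *\<^sub>R v\<close>.\<close>

lemma iterated_average:
  assumes "equivariant f"
  obtains g where "equivariant g"
    "\<And>w c. (\<And>p. dist (f p) (f (p + w)) \<le> c) \<Longrightarrow> (\<And>p. dist (g p) (g (p + w)) \<le> c)"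
    "\<And>c. (\<And>p. dist (f p) (f (p + 2 ^ k *\<^sub>R v)) \<le> c) \<Longrightarrow> (\<And>p. dist (g p) (g (p + v)) \<le> c / 2 ^ k)"
proof -
  have "\<exists>g. equivariant g \<and>
    (\<forall>w c. (\<forall>p. dist (f p) (f (p + w)) \<le> c) \<longrightarrow> (\<forall>p. dist (g p) (g (p + w)) \<le> c)) \<and>
    (\<forall>c. (\<forall>p. dist (f p) (f (p + 2 ^ k *\<^sub>R v)) \<le> c) \<longrightarrow> (\<forall>p. dist (g p) (g (p + v)) \<le> c / 2 ^ k))"
  proof (induction k arbitrary: v)
    case 0
    show ?case using assms by (intro exI[of _ f]) simp
  next
    case (Suc k)
    obtain g where g: "equivariant g"
      "\<And>w c p. \<forall>p. dist (f p) (f (p + w)) \<le> c \<Longrightarrow> dist (g p) (g (p + w)) \<le> c"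
      "\<And>c p. \<forall>p. dist (f p) (f (p + 2 ^ k *\<^sub>R 2 *\<^sub>R v)) \<le> c \<Longrightarrow>
         dist (g p) (g (p + 2 *\<^sub>R v)) \<le> c / 2 ^ k"
      using Suc.IH[of "2 *\<^sub>R v"] by blast
    show ?case
    proof (intro exI[of _ "average v g"] conjI allI impI)
      show "equivariant (average v g)" using g(1) by (rule equivariant_average)
      show "dist (average v g p) (average v g (p + w)) \<le> c"
        if "\<forall>p. dist (f p) (f (p + w)) \<le> c" for w c p
        using g(2)[OF that] by (rule average_displ_le)
      show "dist (average v g p) (average v g (p + v)) \<le> c / 2 ^ Suc k"
        if "\<forall>p. dist (f p) (f (p + 2 ^ Suc k *\<^sub>R v)) \<le> c" for c p
      proof -
        have "\<forall>p. dist (f p) (f (p + 2 ^ k *\<^sub>R 2 *\<^sub>R v)) \<le> c" using that by (simp add: mult.commute)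
        then have "dist (average v g p) (average v g (p + v)) \<le> (c / 2 ^ k) / 2"
          by (intro average_displ_halved g(3))
        then show ?thesis by (simp add: mult.commute)
      qed
    qed
  qed
  then show ?thesis using that by blast
qed

text \<open>The pairs are treated one at a time. Each starts from the bound by \<open>displ\<close>,
  which persists, and the earlier pairs survive since averaging preserves displacement
  bounds.\<close>

lemma almost_minimal_map:
  assumes "finite I" "\<And>v e. (v, e) \<in> I \<Longrightarrow> e > 0"
  obtains f where "equivariant f" "\<And>w p. dist (f p) (f (p + w)) \<le> displ w"
    "\<And>v e p. (v, e) \<in> I \<Longrightarrow> dist (f p) (f (p + v)) \<le> stable v + e"
proof -
  have "\<exists>f. equivariant f \<and> (\<forall>w p. dist (f p) (f (p + w)) \<le> displ w) \<and>
    (\<forall>(v, e)\<in>I. \<forall>p. dist (f p) (f (p + v)) \<le> stable v + e)"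
    using assms
  proof (induction I rule: finite_induct)
    case empty
    then show ?case using equivariant_step dist_step_le_displ by blast
  next
    case (insert z I)
    obtain v e where z: "z = (v, e)" by (cases z)
    have e: "e > 0" using insert.prems z by blast
    obtain f where f: "equivariant f" "\<And>w p. dist (f p) (f (p + w)) \<le> displ w"
      "\<And>v e p. (v, e) \<in> I \<Longrightarrow> dist (f p) (f (p + v)) \<le> stable v + e"
      using insert.IH insert.prems by fastforce
    obtain T where T: "\<And>t. t \<ge> T \<Longrightarrow> displ (t *\<^sub>R v) \<le> t * (stable v + e)"
      using stable_approx[OF e] by metis
    \<comment> \<open>With \<open>2 ^ k\<close> past the threshold \<open>T\<close>, halving
      \<open>k\<close> times brings the displacement within \<open>e\<close> of
      \<open>stable v\<close>.\<close>
    obtain k where k: "T < 2 ^ k" using real_arch_pow[of 2 T] by auto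
    obtain g where g: "equivariant g"
      "\<And>w c p. (\<And>p. dist (f p) (f (p + w)) \<le> c) \<Longrightarrow> dist (g p) (g (p + w)) \<le> c"
      "\<And>c p. (\<And>p. dist (f p) (f (p + 2 ^ k *\<^sub>R v)) \<le> c) \<Longrightarrow> dist (g p) (g (p + v)) \<le> c / 2 ^ k"
      using iterated_average[OF f(1), of k v] by blast
    have "dist (g p) (g (p + v)) \<le> stable v + e" for p
    proof -
      have "dist (g p) (g (p + v)) \<le> displ (2 ^ k *\<^sub>R v) / 2 ^ k" by (rule g(3)) (rule f(2))
      also have "\<dots> \<le> stable v + e"
        using T[of "2 ^ k"] k by (simp add: field_simps)
      finally show ?thesis .
    qed
    then show ?case using g(1) g(2)[OF f(2)] g(2)[OF f(3)] z by blast
  qed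
  then show ?thesis using that by blast
qed

text \<open>Replacing \<open>x\<^sub>0\<close> by \<open>x\<close> changes the displacement under
  the \<open>k\<close>-th multiple of \<open>a\<close> by at most
  \<open>2 * dist x\<^sub>0 x\<close>, which disappears after division by \<open>k\<close>; the
  displacement of \<open>x\<close> itself grows at most linearly in \<open>k\<close>.\<close>

lemma stable_le_dist_act: "stable (real_vec a) \<le> dist x (\<psi> a x)"
proof -
  obtain \<alpha> where \<alpha>: "\<alpha> 0 = 0" "\<And>k. \<alpha> (Suc k) = a + \<alpha> k" "\<And>k. real_vec (\<alpha> k) = real k *\<^sub>R real_vec a"
  proof
    show "of_nat 0 * a = 0" "\<And>k. of_nat (Suc k) * a = a + of_nat k * a"
      by (simp_all add: algebra_simps)
    show "real_vec (of_nat k * a) = real k *\<^sub>R real_vec a" for k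
      by (induction k) (simp_all add: algebra_simps real_vec_add)
  qed
  have le: "dist x (\<psi> (\<alpha> k) x) \<le> real k * dist x (\<psi> a x)" for k
  proof (induction k)
    case (Suc k)
    have "dist x (\<psi> (\<alpha> (Suc k)) x) \<le> dist x (\<psi> a x) + dist (\<psi> a x) (\<psi> a (\<psi> (\<alpha> k) x))"
      unfolding \<alpha> act_add by (rule dist_triangle)
    then show ?case using Suc by (simp add: act_isometry algebra_simps)
  qed (simp add: \<alpha> act_zero)
  have "stable (real_vec a) \<le> dist x (\<psi> a x) + e" if e: "e > 0" for e
  proof -
    obtain k where k: "2 * dist x\<^sub>0 x < real k * e"
      using reals_Archimedean3[OF e] by blast
    moreover have "0 \<le> 2 * dist x\<^sub>0 x" by simp
    ultimately have "k > 0" by (intro gr0I) auto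
    have "stable (real_vec a) \<le> displ (real_vec (\<alpha> k)) / k"
      using stable_le[of k "real_vec a"] \<open>k > 0\<close> by (simp add: \<alpha>)
    also have "displ (real_vec (\<alpha> k)) \<le> dist x\<^sub>0 x + dist x (\<psi> (\<alpha> k) x) + dist (\<psi> (\<alpha> k) x) (\<psi> (\<alpha> k) x\<^sub>0)"
      unfolding displ_real_vec by (rule dist_triangle_path)
    also have "\<dots> \<le> real k * e + real k * dist x (\<psi> a x)"
      using le[of k] k by (simp add: act_isometry dist_commute)
    also have "\<dots> / k = dist x (\<psi> a x) + e" using \<open>k > 0\<close> by (simp add: field_simps)
    finally show ?thesis using \<open>k > 0\<close> by (simp add: divide_right_mono)
  qed
  then show ?thesis by (rule field_le_epsilon)
qed

text \<open>For the lower bound take a multiple \<open>k w\<close> close to a lattice point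
  \<open>a\<close>. The images of \<open>p\<close>, \<open>p + w\<close>, \<open>p + k w\<close>,
  \<open>p + a\<close> form a path of length at least \<open>stable (real_vec a)\<close>, which is
  almost \<open>k * stable w\<close>. The middle leg has at most \<open>(k - 1) * stable w\<close>
  and the last almost nothing, so the first has almost \<open>stable w\<close>.\<close>

lemma minimal_map_isometric:
  assumes f: "equivariant f" and le: "\<And>p v. dist (f p) (f (p + v)) \<le> stable v"
  shows "dist (f p) (f q) = stable (p - q)"
proof -
  define w where "w = q - p"
  have "stable w \<le> dist (f p) (f (p + w)) + e" if e: "e > 0" for e
  proof -
    obtain B where B: "B > 0" "\<And>v. stable v \<le> B * norm v"
      using stable_bounded_by_norm by blast
    \<comment> \<open>The error \<open>u\<close> enters twice, in comparing \<open>k w\<close> with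
      \<open>a\<close> and in the last leg, hence the factor 2.\<close>
    obtain k a where k: "k > 0" and a: "norm (real k *\<^sub>R w - real_vec a) < e / (2 * B)"
      using simultaneous_approximation[of "e / (2 * B)" w] e B by auto
    define u where "u = real k *\<^sub>R w - real_vec a"
    have u: "stable u \<le> e / 2"
      using B(2)[of u] a B(1) mult_strict_left_mono[OF a B(1)] unfolding u_def by simp
    have "real k * stable w = stable (real_vec a + u)" by (simp add: stable_scaleR u_def)
    also have "\<dots> \<le> stable (real_vec a) + stable u" by (rule stable_triangle)
    also have "stable (real_vec a) \<le> dist (f p) (f (p + real_vec a))"
      using stable_le_dist_act[of a "f p"] f by (simp add: equivariant_def)
    also have "\<dots> \<le> dist (f p) (f (p + w)) + dist (f (p + w)) (f (p + real k *\<^sub>R w))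
        + dist (f (p + real k *\<^sub>R w)) (f (p + real_vec a))"
      by (rule dist_triangle_path)
    also have "dist (f (p + w)) (f (p + real k *\<^sub>R w)) \<le> (real k - 1) * stable w"
    proof -
      have "p + w + (real k - 1) *\<^sub>R w = p + real k *\<^sub>R w" by (simp add: algebra_simps)
      from le[of "p + w" "(real k - 1) *\<^sub>R w", unfolded this] show ?thesis
        using k by (simp add: stable_scaleR)
    qed
    also have "dist (f (p + real k *\<^sub>R w)) (f (p + real_vec a)) \<le> stable u"
      using le[of "p + real_vec a" u] by (simp add: dist_commute u_def algebra_simps)
    finally show ?thesis using u by (simp add: algebra_simps)
  qed
  then have "stable w \<le> dist (f p) (f (p + w))" by (rule field_le_epsilon)
  then have "dist (f p) (f (p + w)) = stable w" using le by (intro antisym) auto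
  then show ?thesis unfolding w_def using stable_minus[of "q - p"] by simp
qed

text \<open>Only definiteness needs an argument. If \<open>stable w = 0\<close>, the lattice points
  obtained by rounding multiples of \<open>w\<close> displace \<open>f 0\<close>, hence
  \<open>x\<^sub>0\<close>, by a bounded amount, so properness leaves finitely many of them; a
  nonzero coordinate of \<open>w\<close> makes them unbounded.\<close>

lemma is_norm_stable:
  assumes proper: "\<And>R. finite {a. dist x\<^sub>0 (\<psi> a x\<^sub>0) \<le> R}"
    and min: "equivariant f" "\<And>p v. dist (f p) (f (p + v)) \<le> stable v"
  shows "is_norm stable"
proof -
  have "w = 0" if w: "stable w = 0" for w
  proof (rule ccontr)
    assume "w \<noteq> 0"
    then obtain i where i: "w $ i \<noteq> 0" by (auto simp: vec_eq_iff)
    obtain B where B: "B > 0" "\<And>v. stable v \<le> B * norm v"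
      using stable_bounded_by_norm by blast
    define a where "a k = floor_vec (real k *\<^sub>R w)" for k
    define R where "R = 2 * dist x\<^sub>0 (f 0) + B * CARD('n)"
    have "dist x\<^sub>0 (\<psi> (a k) x\<^sub>0) \<le> R" for k
    proof -
      have "dist (f 0) (\<psi> (a k) (f 0)) \<le> stable (real_vec (a k))"
        using min(1) min(2)[of 0 "real_vec (a k)"] by (simp add: equivariant_def)
      also have "\<dots> = stable (real k *\<^sub>R w + - (real k *\<^sub>R w - real_vec (a k)))" by simp
      also have "\<dots> \<le> stable (real k *\<^sub>R w) + stable (- (real k *\<^sub>R w - real_vec (a k)))"
        by (rule stable_triangle)
      also have "\<dots> = stable (real k *\<^sub>R w - real_vec (a k))"
        unfolding stable_minus by (simp add: stable_scaleR w)
      also have "\<dots> \<le> B * norm (real k *\<^sub>R w - real_vec (a k))" by (rule B)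
      also have "\<dots> \<le> B * CARD('n)"
        using B norm_minus_floor_vec_le unfolding a_def by (intro mult_left_mono) auto
      finally have "dist (f 0) (\<psi> (a k) (f 0)) \<le> B * CARD('n)" .
      moreover have "dist x\<^sub>0 (\<psi> (a k) x\<^sub>0)
          \<le> dist x\<^sub>0 (f 0) + dist (f 0) (\<psi> (a k) (f 0)) + dist (\<psi> (a k) (f 0)) (\<psi> (a k) x\<^sub>0)"
        by (rule dist_triangle_path)
      ultimately show ?thesis by (simp add: R_def act_isometry dist_commute)
    qed
    then have "finite (range a)" by (intro finite_subset[OF _ proper[of R]]) auto
    then have "finite ((\<lambda>b. \<bar>b $ i\<bar>) ` range a)" by simp
    then obtain C where C: "\<And>k. \<bar>a k $ i\<bar> \<le> C"
      using bdd_above_finite unfolding bdd_above_def by (metis image_eqI rangeI)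
    obtain k where "real_of_int C + 1 < real k * \<bar>w $ i\<bar>"
      using reals_Archimedean3[of "\<bar>w $ i\<bar>"] i by auto
    then have "real_of_int C + 1 < \<bar>real k * w $ i\<bar>" by (simp add: abs_mult)
    moreover have "\<bar>\<lfloor>real k * w $ i\<rfloor>\<bar> \<le> C" using C[of k] by (simp add: a_def floor_vec_def)
    ultimately show False by linarith
  qed
  then have "stable w = 0 \<longleftrightarrow> w = 0" for w using stable_zero by blast
  then show ?thesis
    by (simp add: is_norm_def stable_nonneg stable_scaleR stable_triangle)
qed

end

section \<open>Compactness and finiteness for proper actions\<close>

lemma compact_Pi_UNIV:
  fixes K :: "'i \<Rightarrow> 'a::topological_space set"
  assumes "\<And>i. compact (K i)"
  shows "compact (Pi UNIV K)"
proof -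
  have "compactin (product_topology (\<lambda>i::'i. euclidean) UNIV) (PiE UNIV K)"
    using assms by (simp add: compactin_PiE)
  then show ?thesis by (simp add: euclidean_product_topology PiE_UNIV_domain)
qed

text \<open>Finitely many balls as in the properness of the action cover \<open>cball y R\<close>.
  If \<open>g\<close> and \<open>g\<^sub>0\<close> move \<open>x\<close> into the same ball, then
  \<open>g\<close> times the inverse of \<open>g\<^sub>0\<close> moves that ball so that it meets
  itself; so each ball accounts for finitely many \<open>g\<close>.\<close>

lemma finite_bounded_displacement:
  fixes \<phi> :: "'g \<Rightarrow> 'x::metric_space \<Rightarrow> 'x"
  assumes proper: "proper_space TYPE('x)" "proper_action G \<phi>"
    and "group_action G UNIV \<phi>"
  shows "finite {g \<in> carrier G. dist y (\<phi> g x) \<le> R}"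
proof -
  interpret group_action G UNIV \<phi> by fact
  interpret group G using group_hom group_hom.axioms(1) by blast
  obtain r where "\<forall>z. r z > 0 \<and> finite {g \<in> carrier G. \<phi> g ` ball z (r z) \<inter> ball z (r z) \<noteq> {}}"
    using choice[OF proper(2)[unfolded proper_action_def]] by blast
  then have r: "\<And>z. r z > 0"
    "\<And>z. finite {g \<in> carrier G. \<phi> g ` ball z (r z) \<inter> ball z (r z) \<noteq> {}}"
    by simp_all
  have "compact (cball y R)" using proper(1) by (simp add: proper_space_def)
  moreover have "cball y R \<subseteq> (\<Union>z. ball z (r z))" using r(1) centre_in_ball by blast
  ultimately obtain C where C: "finite C" "cball y R \<subseteq> (\<Union>z\<in>C. ball z (r z))"
    by (rule compactE_image[OF _ open_ball]) metis
  have "finite {g \<in> carrier G. \<phi> g x \<in> ball z (r z)}" (is "finite ?F") for z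
  proof (cases "?F = {}")
    case False
    then obtain g\<^sub>0 where g\<^sub>0: "g\<^sub>0 \<in> carrier G" "\<phi> g\<^sub>0 x \<in> ball z (r z)" by blast
    have "?F \<subseteq> (\<lambda>h. h \<otimes>\<^bsub>G\<^esub> g\<^sub>0) ` {g \<in> carrier G. \<phi> g ` ball z (r z) \<inter> ball z (r z) \<noteq> {}}"
    proof
      fix g assume g: "g \<in> ?F"
      define h where "h = g \<otimes>\<^bsub>G\<^esub> inv\<^bsub>G\<^esub> g\<^sub>0"
      have h: "h \<in> carrier G" "g = h \<otimes>\<^bsub>G\<^esub> g\<^sub>0" using g g\<^sub>0 by (auto simp: h_def m_assoc)
      have "\<phi> h (\<phi> g\<^sub>0 x) = \<phi> g x"
        unfolding h(2) using h(1) g\<^sub>0(1) by (simp add: composition_rule)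
      then have "\<phi> h (\<phi> g\<^sub>0 x) \<in> ball z (r z)" using g by simp
      then have "\<phi> h (\<phi> g\<^sub>0 x) \<in> \<phi> h ` ball z (r z) \<inter> ball z (r z)"
        using imageI[OF g\<^sub>0(2), of "\<phi> h"] by (rule IntI[rotated])
      then have "\<phi> h ` ball z (r z) \<inter> ball z (r z) \<noteq> {}" by (metis emptyE)
      then show "g \<in> (\<lambda>h. h \<otimes>\<^bsub>G\<^esub> g\<^sub>0) ` {g \<in> carrier G. \<phi> g ` ball z (r z) \<inter> ball z (r z) \<noteq> {}}"
        using h by blast
    qed
    then show ?thesis by (rule finite_surj[OF r(2)])
  qed (metis finite.emptyI)
  then have "finite (\<Union>z\<in>C. {g \<in> carrier G. \<phi> g x \<in> ball z (r z)})" using C by blast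
  then show ?thesis
  proof (rule rev_finite_subset, intro subsetI)
    fix g assume g: "g \<in> {g \<in> carrier G. dist y (\<phi> g x) \<le> R}"
    then have "\<phi> g x \<in> (\<Union>z\<in>C. ball z (r z))" by (intro subsetD[OF C(2)]) simp
    then show "g \<in> (\<Union>z\<in>C. {g \<in> carrier G. \<phi> g x \<in> ball z (r z)})" using g by blast
  qed
qed

lemma (in group) conjugate_mult:
  assumes "g \<in> carrier G" "x \<in> carrier G" "y \<in> carrier G"
  shows "g \<otimes> (x \<otimes> y) \<otimes> inv g = (g \<otimes> x \<otimes> inv g) \<otimes> (g \<otimes> y \<otimes> inv g)"
proof -
  have "inv g \<otimes> (g \<otimes> (y \<otimes> inv g)) = y \<otimes> inv g"
    using assms by (simp add: m_assoc[symmetric])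
  then show ?thesis using assms by (simp add: m_assoc)
qed

text \<open>Agreement of two conjugates passes to differences by cancellation. Thus a conjugate of
  the lattice action is determined by finitely many group elements, which properness can
  count.\<close>

lemma (in group) conjugates_eq_of_axes:
  fixes \<iota> :: "int ^ 'n \<Rightarrow> 'a"
  assumes hom: "\<iota> \<in> hom int_vec_group G"
    and g: "g \<in> carrier G" "h \<in> carrier G"
    and axis: "\<And>i. g \<otimes> \<iota> (axis i 1) \<otimes> inv g = h \<otimes> \<iota> (axis i 1) \<otimes> inv h"
  shows "g \<otimes> \<iota> a \<otimes> inv g = h \<otimes> \<iota> a \<otimes> inv h"
proof (induction a rule: additive_induct_int_vec)
  case (1 i)
  show ?case by (rule axis)
next
  case (2 a b)
  have in_carrier: "\<iota> c \<in> carrier G" for c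
    using hom by (auto simp: hom_def int_vec_group_def)
  have add: "\<iota> (c + d) = \<iota> c \<otimes> \<iota> d" for c d
    using hom by (auto simp: hom_def int_vec_group_def)
  have "(g \<otimes> \<iota> (a - b) \<otimes> inv g) \<otimes> (g \<otimes> \<iota> b \<otimes> inv g) = g \<otimes> \<iota> a \<otimes> inv g"
    using g in_carrier by (simp add: conjugate_mult[symmetric] add[symmetric])
  moreover have "(h \<otimes> \<iota> (a - b) \<otimes> inv h) \<otimes> (h \<otimes> \<iota> b \<otimes> inv h) = h \<otimes> \<iota> a \<otimes> inv h"
    using g in_carrier by (simp add: conjugate_mult[symmetric] add[symmetric])
  ultimately have "(g \<otimes> \<iota> (a - b) \<otimes> inv g) \<otimes> (h \<otimes> \<iota> b \<otimes> inv h)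
      = (h \<otimes> \<iota> (a - b) \<otimes> inv h) \<otimes> (h \<otimes> \<iota> b \<otimes> inv h)"
    using 2 by simp
  then show ?case using g in_carrier by simp
qed

lemma closed_displacement_le:
  "closed {h :: 'v::real_normed_vector \<Rightarrow> 'x::metric_space. \<forall>p. dist (h p) (h (p + v)) \<le> c}"
  by (intro closed_Collect_all closed_Collect_le continuous_intros continuous_on_product_coordinates)

lemma closed_Collect_equivariant:
  fixes \<theta> :: "int ^ 'n \<Rightarrow> 'x::metric_space \<Rightarrow> 'x"
  assumes "\<And>a. continuous_on UNIV (\<theta> a)"
  shows "closed {h. \<forall>p a. \<theta> a (h p) = h (p + real_vec a)}"
proof (intro closed_Collect_all closed_Collect_eq)
  show "continuous_on UNIV (\<lambda>h. \<theta> a (h p))" for a and p :: "real ^ 'n"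
    by (rule continuous_on_compose2[OF assms continuous_on_product_coordinates]) simp
qed (rule continuous_on_product_coordinates)

section \<open>A minimal equivariant map by compactness\<close>

theorem theorem1p2:
  fixes \<sigma> :: "'x::metric_space \<Rightarrow> 'x \<Rightarrow> real \<Rightarrow> 'x"
    and \<Gamma> :: "('g, 'm) monoid_scheme"
    and \<phi> :: "'g \<Rightarrow> 'x \<Rightarrow> 'x"
    and A :: "'g set"
    and \<iota> :: "int ^ 'n \<Rightarrow> 'g"
  assumes "proper_space TYPE('x)"
    and "consistent_bicombing \<sigma>"
    and "group \<Gamma>"
    and "isometric_action \<Gamma> \<phi>"
    and "proper_action \<Gamma> \<phi>"
    and "cocompact_action \<Gamma> \<phi>"
    and "equivariant_bicombing \<Gamma> \<phi> \<sigma>"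
    and "subgroup A \<Gamma>"
    and "\<iota> \<in> iso int_vec_group (\<Gamma>\<lparr>carrier := A\<rparr>)"
  shows "\<exists>(N :: real ^ 'n \<Rightarrow> real) (f :: real ^ 'n \<Rightarrow> 'x).
           is_norm N \<and>
           (\<forall>p q. dist (f p) (f q) = N (p - q)) \<and>
           (\<forall>p a. \<phi> (\<iota> a) (f p) = f (p + real_vec a))"
proof -
  interpret group \<Gamma> by fact
  have action: "group_action \<Gamma> UNIV \<phi>"
    and isometry: "\<And>g x y. g \<in> carrier \<Gamma> \<Longrightarrow> dist (\<phi> g x) (\<phi> g y) = dist x y"
    using assms(4) by (auto simp: isometric_action_def)
  interpret group_action \<Gamma> UNIV \<phi> by fact
  have act_mult: "\<phi> (g \<otimes>\<^bsub>\<Gamma>\<^esub> h) x = \<phi> g (\<phi> h x)" if "g \<in> carrier \<Gamma>" "h \<in> carrier \<Gamma>" for g h x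
    using composition_rule that by simp
  have act_one: "\<phi> \<one>\<^bsub>\<Gamma>\<^esub> x = x" for x
    using id_eq_one by (metis UNIV_I restrict_apply')
  have act_inv: "\<phi> (inv\<^bsub>\<Gamma>\<^esub> g) (\<phi> g x) = x" if "g \<in> carrier \<Gamma>" for g x
    using that by (simp add: act_mult[symmetric] act_one)
  have \<iota>_hom: "\<iota> \<in> hom int_vec_group \<Gamma>" and \<iota>_inj: "inj \<iota>"
    using assms(9) subgroup.subset[OF assms(8)]
    by (auto simp: iso_def hom_def int_vec_group_def bij_betw_def)
  have \<iota>_carrier: "\<iota> a \<in> carrier \<Gamma>" for a
    using \<iota>_hom by (auto simp: hom_def int_vec_group_def)
  have \<iota>_add: "\<iota> (a + b) = \<iota> a \<otimes>\<^bsub>\<Gamma>\<^esub> \<iota> b" for a b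
    using \<iota>_hom by (auto simp: hom_def int_vec_group_def)
  have \<iota>_zero: "\<iota> 0 = \<one>\<^bsub>\<Gamma>\<^esub>"
    using \<iota>_add[of 0 0] \<iota>_carrier[of 0] by (simp add: l_cancel_one)
  have comb: "\<And>x y t. t \<in> {0..1} \<Longrightarrow> \<sigma> y x t = \<sigma> x y (1 - t)"
    "\<And>x y x' y' t. t \<in> {0..1} \<Longrightarrow> dist (\<sigma> x y t) (\<sigma> x' y' t) \<le> (1 - t) * dist x x' + t * dist y y'"
    using assms(2) unfolding consistent_bicombing_def bicombing_def by blast+
  define x\<^sub>0 where "x\<^sub>0 = (undefined :: 'x)"
  interpret lattice_action "\<lambda>x y. \<sigma> x y (1 / 2)" "\<lambda>a. \<phi> (\<iota> a)" x\<^sub>0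
  proof
    show "\<sigma> x y (1 / 2) = \<sigma> y x (1 / 2)" for x y using comb(1)[of "1 / 2" x y] by simp
    show "dist (\<sigma> x y (1 / 2)) (\<sigma> x' y' (1 / 2)) \<le> (dist x x' + dist y y') / 2" for x y x' y'
      using comb(2)[of "1 / 2" x y x' y'] by simp
    show "\<phi> (\<iota> a) (\<sigma> x y (1 / 2)) = \<sigma> (\<phi> (\<iota> a) x) (\<phi> (\<iota> a) y) (1 / 2)" for a x y
      using assms(7) \<iota>_carrier by (simp add: equivariant_bicombing_def)
  qed (simp_all add: \<iota>_zero act_one \<iota>_add act_mult \<iota>_carrier isometry)
  obtain K where K: "compact K" "(\<Union>g\<in>carrier \<Gamma>. \<phi> g ` K) = UNIV"
    using assms(6) unfolding cocompact_action_def by blast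
  obtain R where R: "K \<subseteq> cball x\<^sub>0 R"
    using compact_imp_bounded[OF K(1)] unfolding bounded_any_center[of _ x\<^sub>0]
    by (metis mem_cball subsetI)
  \<comment> \<open>Moving an equivariant map by \<open>g\<close> makes it equivariant for the
    action through \<open>conj g\<close>. Distinct \<open>g\<close> may give the same function
    \<open>conj g\<close>, so the image of \<open>F\<close> below can be finite even if
    \<open>F\<close> is not.\<close>
  define conj where "conj g a = g \<otimes>\<^bsub>\<Gamma>\<^esub> \<iota> a \<otimes>\<^bsub>\<Gamma>\<^esub> inv\<^bsub>\<Gamma>\<^esub> g" for g a
  have conj_carrier: "conj g a \<in> carrier \<Gamma>" if "g \<in> carrier \<Gamma>" for g a
    using that \<iota>_carrier by (simp add: conj_def)
  have conj_act: "\<phi> (conj g a) (\<phi> g x) = \<phi> g (\<phi> (\<iota> a) x)" if "g \<in> carrier \<Gamma>" for g a x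
    using that \<iota>_carrier by (simp add: conj_def act_mult act_inv)
  \<comment> \<open>The bound comes from the detour over a point \<open>h 0\<close> within
    \<open>R\<close> of \<open>x\<^sub>0\<close>: two legs of length at most \<open>R\<close> and
    the displacement of \<open>h 0\<close>.\<close>
  define F where "F = {g \<in> carrier \<Gamma>. \<forall>i. dist x\<^sub>0 (\<phi> (conj g (axis i 1)) x\<^sub>0)
      \<le> 2 * R + displ (real_vec (axis i 1))}"
  have "finite (conj ` F)"
  proof (rule inj_on_finite)
    show "inj_on (\<lambda>c i. c (axis i 1)) (conj ` F)"
    proof (rule inj_onI, clarsimp)
      fix g h assume gh: "g \<in> F" "h \<in> F"
        and eq: "(\<lambda>i. conj g (axis i 1)) = (\<lambda>i. conj h (axis i 1))"
      show "conj g = conj h"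
        unfolding conj_def
      proof (rule ext, rule conjugates_eq_of_axes[OF \<iota>_hom])
        show "g \<in> carrier \<Gamma>" "h \<in> carrier \<Gamma>" using gh by (auto simp: F_def)
        show "g \<otimes>\<^bsub>\<Gamma>\<^esub> \<iota> (axis i 1) \<otimes>\<^bsub>\<Gamma>\<^esub> inv\<^bsub>\<Gamma>\<^esub> g = h \<otimes>\<^bsub>\<Gamma>\<^esub> \<iota> (axis i 1) \<otimes>\<^bsub>\<Gamma>\<^esub> inv\<^bsub>\<Gamma>\<^esub> h" for i
          using fun_cong[OF eq, of i] by (simp add: conj_def)
      qed
    qed
    show "(\<lambda>c i. c (axis i 1)) ` conj ` F
        \<subseteq> Pi\<^sub>E UNIV (\<lambda>i. {g \<in> carrier \<Gamma>. dist x\<^sub>0 (\<phi> g x\<^sub>0) \<le> 2 * R + displ (real_vec (axis i 1))})"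
      by (auto simp: F_def conj_carrier)
    show "finite (Pi\<^sub>E UNIV (\<lambda>i::'n. {g \<in> carrier \<Gamma>. dist x\<^sub>0 (\<phi> g x\<^sub>0) \<le> 2 * R + displ (real_vec (axis i 1))}))"
      by (intro finite_PiE finite finite_bounded_displacement assms(1,5) action)
  qed
  \<comment> \<open>Moving maps into a compact region conjugates their equivariance, so all
    admissible conjugates are allowed at once; their finite number keeps the union closed.\<close>
  define W where "W = (\<Union>c\<in>conj ` F. {h. \<forall>p a. \<phi> (c a) (h p) = h (p + real_vec a)})"
  have closed_W: "closed W"
    unfolding W_def
  proof (intro closed_UN \<open>finite (conj ` F)\<close> ballI closed_Collect_equivariant)
    fix c a assume "c \<in> conj ` F"
    then have "c a \<in> carrier \<Gamma>" using conj_carrier by (auto simp: F_def)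
    then have "1-lipschitz_on UNIV (\<phi> (c a))" by (simp add: lipschitz_on_def isometry)
    then show "continuous_on UNIV (\<phi> (c a))" by (rule lipschitz_on_continuous_on)
  qed
  \<comment> \<open>Room for the translated maps: \<open>h 0\<close> is within \<open>R\<close> of
    \<open>x\<^sub>0\<close>, and \<open>h p\<close> within \<open>displ p\<close> of
    \<open>h 0\<close>.\<close>
  define U where "U = Pi UNIV (\<lambda>p. cball x\<^sub>0 (R + displ p))"
  have compact_U: "compact U"
    unfolding U_def using assms(1) by (intro compact_Pi_UNIV) (simp add: proper_space_def)
  \<comment> \<open>A map in every \<open>Z (v, e)\<close> with \<open>e > 0\<close> is minimal;
    \<open>almost_minimal_map\<close> reaches any finite number of these sets.\<close>
  define Z where "Z = (\<lambda>(v, e). {h :: real ^ 'n \<Rightarrow> 'x. \<forall>p. dist (h p) (h (p + v)) \<le> stable v + e})"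
  have "(U \<inter> W) \<inter> (\<Inter>z \<in> UNIV \<times> {0<..}. Z z) \<noteq> {}"
  proof (rule compact_imp_fip_image)
    show "compact (U \<inter> W)" using compact_U closed_W by (rule compact_Int_closed)
    show "closed (Z z)" for z unfolding Z_def by (cases z) (simp add: closed_displacement_le)
    fix I :: "((real ^ 'n) \<times> real) set"
    assume I: "finite I" "I \<subseteq> UNIV \<times> {0<..}"
    then obtain f where f: "equivariant f" "\<And>w p. dist (f p) (f (p + w)) \<le> displ w"
      "\<And>v e p. (v, e) \<in> I \<Longrightarrow> dist (f p) (f (p + v)) \<le> stable v + e"
      using almost_minimal_map[OF I(1)] by blast
    obtain k g where g: "g \<in> carrier \<Gamma>" "k \<in> K" "f 0 = \<phi> g k" using K(2) by blast
    \<comment> \<open>Translation by \<open>g'\<close> brings \<open>f 0\<close> into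
      \<open>K\<close> and changes no displacement.\<close>
    define g' where "g' = inv\<^bsub>\<Gamma>\<^esub> g"
    have g': "g' \<in> carrier \<Gamma>" "\<phi> g' (f 0) \<in> K" using g by (auto simp: g'_def act_inv)
    define h where "h p = \<phi> g' (f p)" for p
    have h_dist: "dist (h p) (h q) = dist (f p) (f q)" for p q
      unfolding h_def using g' isometry by blast
    have h0: "dist x\<^sub>0 (h 0) \<le> R" using R g' by (auto simp: h_def)
    have h_equiv: "\<phi> (conj g' a) (h p) = h (p + real_vec a)" for a p
      using g'(1) f(1) by (simp add: h_def conj_act equivariant_def)
    have "h \<in> U"
      unfolding U_def
    proof (intro Pi_I)
      fix p
      have "dist x\<^sub>0 (h p) \<le> dist x\<^sub>0 (h 0) + dist (h 0) (h p)" by (rule dist_triangle)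
      then show "h p \<in> cball x\<^sub>0 (R + displ p)" using h0 f(2)[of 0 p] by (simp add: h_dist)
    qed
    moreover have "g' \<in> F"
      unfolding F_def
    proof (intro CollectI conjI allI g')
      fix i
      let ?c = "conj g' (axis i 1)"
      have "dist x\<^sub>0 (\<phi> ?c x\<^sub>0) \<le> dist x\<^sub>0 (h 0) + dist (h 0) (\<phi> ?c (h 0)) + dist (\<phi> ?c (h 0)) (\<phi> ?c x\<^sub>0)"
        by (rule dist_triangle_path)
      moreover have "dist (\<phi> ?c (h 0)) (\<phi> ?c x\<^sub>0) = dist x\<^sub>0 (h 0)"
        using isometry[OF conj_carrier[OF g'(1)]] by (simp add: dist_commute)
      moreover have "dist (h 0) (\<phi> ?c (h 0)) \<le> displ (real_vec (axis i 1))"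
        unfolding h_equiv h_dist by (rule f(2))
      ultimately show "dist x\<^sub>0 (\<phi> ?c x\<^sub>0) \<le> 2 * R + displ (real_vec (axis i 1))"
        using h0 by linarith
    qed
    then have "h \<in> W" unfolding W_def using h_equiv by blast
    moreover have "h \<in> (\<Inter>z\<in>I. Z z)" using f(3) by (auto simp: Z_def h_dist)
    ultimately show "(U \<inter> W) \<inter> (\<Inter>z\<in>I. Z z) \<noteq> {}" by blast
  qed
  then obtain h where h: "h \<in> W" "\<And>v e. e > 0 \<Longrightarrow> h \<in> Z (v, e)" by auto
  then obtain g where g: "g \<in> carrier \<Gamma>" "\<And>p a. \<phi> (conj g a) (h p) = h (p + real_vec a)"
    by (auto simp: W_def F_def)
  \<comment> \<open>Translating the limit map back by the inverse undoes the conjugation, so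
    equivariance holds for \<iota> itself.\<close>
  define g' where "g' = inv\<^bsub>\<Gamma>\<^esub> g"
  have g': "g' \<in> carrier \<Gamma>" using g by (simp add: g'_def)
  define f where "f p = \<phi> g' (h p)" for p
  have "equivariant f"
    unfolding equivariant_def
  proof (intro allI)
    fix p a
    have "\<phi> g' (\<phi> (conj g a) (h p)) = \<phi> (\<iota> a) (\<phi> g' (h p))"
      using g(1) \<iota>_carrier by (simp add: conj_def g'_def act_mult act_inv)
    then show "\<phi> (\<iota> a) (f p) = f (p + real_vec a)" by (simp add: f_def g(2))
  qed
  moreover have f_le: "dist (f p) (f (p + v)) \<le> stable v" for p v
  proof (rule field_le_epsilon)
    fix e :: real assume "e > 0"
    from h(2)[OF this, of v] show "dist (f p) (f (p + v)) \<le> stable v + e"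
      by (simp add: f_def isometry[OF g'] Z_def)
  qed
  moreover have "finite {a. dist x\<^sub>0 (\<phi> (\<iota> a) x\<^sub>0) \<le> R}" for R
  proof (rule inj_on_finite)
    show "inj_on \<iota> {a. dist x\<^sub>0 (\<phi> (\<iota> a) x\<^sub>0) \<le> R}" using \<iota>_inj by (rule inj_on_subset) simp
    show "\<iota> ` {a. dist x\<^sub>0 (\<phi> (\<iota> a) x\<^sub>0) \<le> R} \<subseteq> {g \<in> carrier \<Gamma>. dist x\<^sub>0 (\<phi> g x\<^sub>0) \<le> R}"
      using \<iota>_carrier by auto
    show "finite {g \<in> carrier \<Gamma>. dist x\<^sub>0 (\<phi> g x\<^sub>0) \<le> R}"
      by (intro finite_bounded_displacement assms(1,5) action)
  qed
  ultimately have "is_norm stable" "dist (f p) (f q) = stable (p - q)"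
      "\<phi> (\<iota> a) (f p) = f (p + real_vec a)" for p q a
    by (auto intro: is_norm_stable minimal_map_isometric simp: equivariant_def)
  then show ?thesis by blast
qed

end
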